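(* Let $P$ be a polygon and let $\mathcal{D}$ be a dissection of $P$ which can be decomposed into a set of towers. Then the frieze $f_{\mathcal{D}}$ is unitary.
   Context: Polygons and friezes. An $n$-gon $P$ ($n\ge 3$) is convex with vertices $0,1,\dots,n-1$ in cyclic order (indices mod $n$). An arc is an unordered pair $(i,j)$ with $i\neq j$; arcs $(i,i+1)$ are boundary arcs, all others are diagonals. Two arcs $(i,j)$, $(k,\ell)$ cross if, cyclically, $i<k<j<\ell$ or $i<\ell<j<k$. A frieze on $P$ over an integral domain $R$ is a map $f:V\times V\to R$ ($V$ the vertex set) such that: $f(i,j)=0$ iff $i=j$; $f(i,i+1)=f(i,i-1)=1$; $f(i,j)=f(j,i)$; and if $(i,j)$, $(k,\ell)$ are crossing diagonals then $f(i,j)f(k,\ell)=f(i,\ell)f(j,k)+f(i,k)f(j,\ell)$ (Ptolemy relation). Friezes from dissections. A dissection $\mathcal{D}$ of $P$ is a set of pairwise non-crossing diagonals of $P$; here all dissections divide $P$ into triangles and quadrilaterals (the subpolygons). The frieze from the dissection, $f_{\mathcal{D}}$, is the frieze on $P$ over $\mathbb{Z}[\sqrt2]$ with $f_{\mathcal{D}}=1$ on every edge of every subpolygon and $f_{\mathcal{D}}=\sqrt2$ on both diagonals of every quadrilateral subpolygon; the values on arcs crossing arcs of $\mathcal{D}$ are determined by iterating the Ptolemy relation. Unitary. A frieze $f$ on $P$ over $R$ is unitary if there is a triangulation $\{\tau_1,\dots,\tau_m\}$ of $P$ (a maximal set of pairwise non-crossing diagonals) with $f(\tau_i)\in R^\times$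 for all $i$. Towers. For $n\ge 0$, an $n$-tower is a dissection of a $(2n+3)$-gon consisting of one triangle and $n$ quadrilaterals such that no vertex is incident to more than two subpolygons (a straight row of $n$ quadrilaterals with a triangle at one end; a $0$-tower is a triangle). A dissection $\mathcal{D}$ of $P$ can be decomposed into a set of towers (equivalently, is a gluing of towers) if $P$ can be decomposed, along arcs of $\mathcal{D}$, into a set of subpolygons such that $\mathcal{D}$ restricted to each of them is a tower. *)

theory Defs
  imports Complex_Main
begin

typedef zsqrt2 = "{x :: real. \<exists>a b :: int. x = of_int a + of_int b * sqrt 2}"
proof
  have "(0 :: real) = of_int 0 + of_int 0 * sqrt 2" by simp
  then show "(0 :: real) \<in> {x. \<exists>a b :: int. x = of_int a + of_int b * sqrt 2}" by blast
qed

setup_lifting type_definition_zsqrt2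

instantiation zsqrt2 :: idom
begin

lift_definition zero_zsqrt2 :: zsqrt2 is "0 :: real"
  by (rule exI[of _ 0], rule exI[of _ 0]) simp

lift_definition one_zsqrt2 :: zsqrt2 is "1 :: real"
  by (rule exI[of _ 1], rule exI[of _ 0]) simp

lift_definition plus_zsqrt2 :: "zsqrt2 \<Rightarrow> zsqrt2 \<Rightarrow> zsqrt2" is "(+) :: real \<Rightarrow> real \<Rightarrow> real"
proof (elim exE)
  fix x y :: real and a b c d :: int
  assume "x = of_int a + of_int b * sqrt 2" "y = of_int c + of_int d * sqrt 2"
  then have "x + y = of_int (a + c) + of_int (b + d) * sqrt 2"
    by (simp add: algebra_simps)
  then show "\<exists>a b :: int. x + y = of_int a + of_int b * sqrt 2" by blast
qed

lift_definition minus_zsqrt2 :: "zsqrt2 \<Rightarrow> zsqrt2 \<Rightarrow> zsqrt2" is "(-) :: real \<Rightarrow> real \<Rightarrow> real"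
proof (elim exE)
  fix x y :: real and a b c d :: int
  assume "x = of_int a + of_int b * sqrt 2" "y = of_int c + of_int d * sqrt 2"
  then have "x - y = of_int (a - c) + of_int (b - d) * sqrt 2"
    by (simp add: algebra_simps)
  then show "\<exists>a b :: int. x - y = of_int a + of_int b * sqrt 2" by blast
qed

lift_definition uminus_zsqrt2 :: "zsqrt2 \<Rightarrow> zsqrt2" is "uminus :: real \<Rightarrow> real"
proof (elim exE)
  fix x :: real and a b :: int
  assume "x = of_int a + of_int b * sqrt 2"
  then have "- x = of_int (- a) + of_int (- b) * sqrt 2"
    by (simp add: algebra_simps)
  then show "\<exists>a b :: int. - x = of_int a + of_int b * sqrt 2" by blast
qed

lift_definition times_zsqrt2 :: "zsqrt2 \<Rightarrow> zsqrt2 \<Rightarrow> zsqrt2" is "(*) :: real \<Rightarrow> real \<Rightarrow> real"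
proof (elim exE)
  fix x y :: real and a b c d :: int
  assume "x = of_int a + of_int b * sqrt 2" "y = of_int c + of_int d * sqrt 2"
  then have "x * y = of_int (a * c + 2 * (b * d)) + of_int (a * d + b * c) * sqrt 2"
    by (simp add: algebra_simps)
  then show "\<exists>a b :: int. x * y = of_int a + of_int b * sqrt 2" by blast
qed

instance
  by standard (transfer, simp add: algebra_simps)+

end

lift_definition sqrt2 :: zsqrt2 is "sqrt 2"
  by (rule exI[of _ 0], rule exI[of _ 1]) simp

text \<open>
  A convex polygon is represented by its finite set of vertices, a set of natural numbers with
  the cyclic order induced by the order of the naturals. The \<open>n\<close>-gon is \<open>{0..<n}\<close>, and a
  polygon cut out of it is a subset of \<open>{0..<n}\<close>. Arcs are unordered pairs \<open>{i, j}\<close>.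
\<close>

definition cyclic :: "nat \<Rightarrow> nat \<Rightarrow> nat \<Rightarrow> bool" where
  "cyclic i j k \<longleftrightarrow> (i < j \<and> j < k) \<or> (j < k \<and> k < i) \<or> (k < i \<and> i < j)"

text \<open>\<open>next_vertex V i j\<close>: walking once around \<open>V\<close>, the vertex \<open>j\<close> comes directly after \<open>i\<close>.\<close>

definition next_vertex :: "nat set \<Rightarrow> nat \<Rightarrow> nat \<Rightarrow> bool" where
  "next_vertex V i j \<longleftrightarrow> i \<in> V \<and> j \<in> V \<and> i \<noteq> j \<and> (\<forall>k\<in>V. \<not> cyclic i k j)"

lemma next_vertex_iff_Suc_mod:
  assumes "n \<ge> 3"
  shows "next_vertex {0..<n} i j \<longleftrightarrow> i < n \<and> j = Suc i mod n"
proof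
  assume nx: "next_vertex {0..<n} i j"
  then have ij: "i < n" "j < n" "i \<noteq> j" and no: "\<And>k. k < n \<Longrightarrow> \<not> cyclic i k j"
    by (auto simp: next_vertex_def)
  show "i < n \<and> j = Suc i mod n"
  proof (cases "Suc i = n")
    case True
    then show ?thesis using ij no[of 0] by (auto simp: cyclic_def)
  next
    case False
    then show ?thesis using ij no[of "Suc i"] by (auto simp: cyclic_def)
  qed
next
  assume "i < n \<and> j = Suc i mod n"
  then show "next_vertex {0..<n} i j"
    using assms by (cases "Suc i = n") (auto simp: next_vertex_def cyclic_def)
qed

definition arcs :: "nat set \<Rightarrow> nat set set" where
  "arcs V = {{i, j} | i j. i \<in> V \<and> j \<in> V \<and> i \<noteq> j}"

definition boundary_arcs :: "nat set \<Rightarrow> nat set set" where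
  "boundary_arcs V = {{i, j} | i j. next_vertex V i j}"

definition diagonals :: "nat set \<Rightarrow> nat set set" where
  "diagonals V = arcs V - boundary_arcs V"

definition crossing :: "nat set \<Rightarrow> nat set \<Rightarrow> bool" where
  "crossing d e \<longleftrightarrow> (\<exists>i j k l. d = {i, j} \<and> e = {k, l} \<and>
     ((cyclic i k j \<and> cyclic j l i) \<or> (cyclic i l j \<and> cyclic j k i)))"

definition frieze :: "nat set \<Rightarrow> (nat \<Rightarrow> nat \<Rightarrow> 'a :: idom) \<Rightarrow> bool" where
  "frieze V f \<longleftrightarrow>
     (\<forall>i\<in>V. \<forall>j\<in>V. f i j = 0 \<longleftrightarrow> i = j) \<and>
     (\<forall>i j. next_vertex V i j \<longrightarrow> f i j = 1 \<and> f j i = 1) \<and>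
     (\<forall>i\<in>V. \<forall>j\<in>V. f i j = f j i) \<and>
     (\<forall>i j k l. {i, j} \<in> diagonals V \<and> {k, l} \<in> diagonals V \<and> crossing {i, j} {k, l} \<longrightarrow>
        f i j * f k l = f i l * f j k + f i k * f j l)"

definition noncrossing_diagonals :: "nat set \<Rightarrow> nat set set \<Rightarrow> bool" where
  "noncrossing_diagonals V D \<longleftrightarrow> D \<subseteq> diagonals V \<and> (\<forall>d\<in>D. \<forall>e\<in>D. \<not> crossing d e)"

definition triangulation :: "nat set \<Rightarrow> nat set set \<Rightarrow> bool" where
  "triangulation V T \<longleftrightarrow> noncrossing_diagonals V T \<and>
     (\<forall>T'. noncrossing_diagonals V T' \<and> T \<subseteq> T' \<longrightarrow> T' = T)"

definition unitary :: "nat set \<Rightarrow> (nat \<Rightarrow> nat \<Rightarrow> 'a :: idom) \<Rightarrow> bool" where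
  "unitary V f \<longleftrightarrow> (\<exists>T. triangulation V T \<and> (\<forall>i j. {i, j} \<in> T \<longrightarrow> f i j dvd 1))"

text \<open>
  \<open>S\<close> is one of the polygons into which the non-crossing diagonals \<open>D\<close> divide \<open>V\<close>: all its
  sides are sides of \<open>V\<close> or arcs in \<open>D\<close>, so no arc in \<open>D\<close> crosses a side of \<open>S\<close>, and an arc in \<open>D\<close>
  could only divide \<open>S\<close> further by joining two of its vertices.
\<close>

definition subpolygon :: "nat set \<Rightarrow> nat set set \<Rightarrow> nat set \<Rightarrow> bool" where
  "subpolygon V D S \<longleftrightarrow> S \<subseteq> V \<and> card S \<ge> 3 \<and>
     boundary_arcs S \<subseteq> boundary_arcs V \<union> D \<and> D \<inter> diagonals S = {}"

definition dissection :: "nat set \<Rightarrow> nat set set \<Rightarrow> bool" where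
  "dissection V D \<longleftrightarrow> noncrossing_diagonals V D \<and>
     (\<forall>S. subpolygon V D S \<longrightarrow> card S = 3 \<or> card S = 4)"

text \<open>These conditions determine \<open>f\<close> on \<open>V \<times> V\<close>, since the remaining values follow from the
  Ptolemy relation.\<close>

definition frieze_from_dissection ::
    "nat set \<Rightarrow> nat set set \<Rightarrow> (nat \<Rightarrow> nat \<Rightarrow> zsqrt2) \<Rightarrow> bool" where
  "frieze_from_dissection V D f \<longleftrightarrow> frieze V f \<and>
     (\<forall>S. subpolygon V D S \<longrightarrow>
        (\<forall>i j. {i, j} \<in> boundary_arcs S \<longrightarrow> f i j = 1) \<and>
        (card S = 4 \<longrightarrow> (\<forall>i j. {i, j} \<in> diagonals S \<longrightarrow> f i j = sqrt2)))"

definition tower :: "nat \<Rightarrow> nat set \<Rightarrow> nat set set \<Rightarrow> bool" where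
  "tower m V D \<longleftrightarrow> card V = 2 * m + 3 \<and> dissection V D \<and>
     card {S. subpolygon V D S \<and> card S = 3} = 1 \<and>
     card {S. subpolygon V D S \<and> card S = 4} = m \<and>
     (\<forall>v\<in>V. card {S. subpolygon V D S \<and> v \<in> S} \<le> 2)"

text \<open>\<open>C\<close> is the set of arcs along which the polygon is cut.\<close>

definition decomposable_into_towers :: "nat set \<Rightarrow> nat set set \<Rightarrow> bool" where
  "decomposable_into_towers V D \<longleftrightarrow>
     (\<exists>C \<subseteq> D. \<forall>Q. subpolygon V C Q \<longrightarrow> (\<exists>m. tower m Q (D \<inter> diagonals Q)))"

end

theory Submission
  imports Defs
begin

text \<open>
  Every tower has a vertex \<open>a\<close> all of whose arcs carry units, so the fan of diagonals at \<open>a\<close>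
  triangulates it by units. Take \<open>a\<close> to be the vertex of the triangle opposite the row of
  quadrilaterals. Let \<open>l\<close>, \<open>r\<close> be the side shared by two consecutive subpolygons and
  \<open>l, x, y, r\<close> the quadrilateral beyond it. If \<open>f a l = f a r = u\<close>, the Ptolemy relation
  for the crossing arcs \<open>{a, x}\<close> and \<open>{l, r}\<close> gives
  \<open>f a x = f a r * f l x + f a l * f x r = u * (1 + sqrt2)\<close>, and \<open>f a y\<close> is the same by symmetry.
  So the values of \<open>f a\<close> along the two long sides of the tower are the powers of \<open>1 + sqrt2\<close>,
  which is a unit with inverse \<open>sqrt2 - 1\<close> (\<open>strip_units\<close>, \<open>tower_apex_units\<close>).

  The row never bends or branches because of the bound on the subpolygons at a vertex: one
  behind the side \<open>{l, r}\<close>, the quadrilateral itself, and one beyond its side \<open>{l, x}\<close> would be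
  three subpolygons at \<open>l\<close>. So the only way on is through the opposite side \<open>{x, y}\<close>.
  Turning this into a proof takes the existence of a subpolygon on a given
  side of an arc, which is \<open>subpolygon_at_side\<close>.

  The towers are put together along the cuts. A cut is an arc of the dissection, hence a side of
  some subpolygon, so \<open>f\<close> is \<open>1\<close> on it. Triangulations of the two parts of a polygon together
  with the cut between them triangulate the whole (\<open>glue_triangulations\<close>), and induction over the
  cuts finishes the proof (\<open>unitary_by_cutting\<close>).
\<close>

section \<open>Cyclic order and arcs\<close>

lemma cyclic_distinct: "cyclic i j k \<Longrightarrow> i \<noteq> j \<and> j \<noteq> k \<and> i \<noteq> k"
  by (auto simp: cyclic_def)

lemma cyclic_rotate: "cyclic i j k \<longleftrightarrow> cyclic j k i"
  by (auto simp: cyclic_def)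

lemma cyclic_asym: "cyclic i j k \<Longrightarrow> \<not> cyclic i k j"
  by (auto simp: cyclic_def)

lemma cyclic_total: "i \<noteq> j \<Longrightarrow> j \<noteq> k \<Longrightarrow> i \<noteq> k \<Longrightarrow> cyclic i j k \<or> cyclic i k j"
  unfolding cyclic_def by linarith

lemma cyclic_trans:
  assumes "cyclic i j k" "cyclic i k l"
  shows "cyclic i j l" "cyclic j k l"
  using assms by (auto simp: cyclic_def)

lemmas cyclic_rules = cyclic_trans cyclic_rotate cyclic_total cyclic_asym cyclic_distinct

lemma boundary_arc_iff: "{x, y} \<in> boundary_arcs V \<longleftrightarrow> next_vertex V x y \<or> next_vertex V y x"
  by (auto simp: boundary_arcs_def doubleton_eq_iff)

text \<open>Since \<open>cyclic x v y\<close> forces \<open>x \<noteq> y\<close>, a diagonal is just an arc with a vertex strictly on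
  either side. In this form diagonals are monotone in the polygon, and arcs that cross are
  visibly diagonals.\<close>

lemma diagonal_iff:
  "{x, y} \<in> diagonals V \<longleftrightarrow>
     x \<in> V \<and> y \<in> V \<and> (\<exists>v\<in>V. cyclic x v y) \<and> (\<exists>v\<in>V. cyclic y v x)"
  unfolding diagonals_def Diff_iff boundary_arc_iff
  by (auto simp: arcs_def doubleton_eq_iff next_vertex_def dest: cyclic_distinct)

lemma diagonal_cases:
  assumes "d \<in> diagonals V"
  obtains x y where "d = {x, y}"
  using assms by (auto simp: diagonals_def arcs_def)

lemma diagonals_mono:
  assumes "S \<subseteq> V"
  shows "diagonals S \<subseteq> diagonals V"
proof
  fix d assume d: "d \<in> diagonals S"
  then obtain x y where xy: "d = {x, y}" by (rule diagonal_cases)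
  show "d \<in> diagonals V"
    using d assms unfolding xy diagonal_iff by blast
qed

lemma crossing_iff:
  "crossing {i, j} {k, l} \<longleftrightarrow>
     (cyclic i k j \<and> cyclic j l i) \<or> (cyclic i l j \<and> cyclic j k i)"
proof
  assume "crossing {i, j} {k, l}"
  then show "(cyclic i k j \<and> cyclic j l i) \<or> (cyclic i l j \<and> cyclic j k i)"
    unfolding crossing_def doubleton_eq_iff by (elim exE conjE) auto
qed (unfold crossing_def, blast)

lemma crossing_commute:
  assumes "crossing {i, j} {k, l}"
  shows "crossing {k, l} {i, j}"
  using assms unfolding crossing_iff by (metis cyclic_rules)

section \<open>Cutting a polygon along an arc\<close>

text \<open>The vertices met when walking around \<open>V\<close> from \<open>x\<close> to \<open>y\<close>, ends included. The arc
  \<open>{x, y}\<close> cuts \<open>V\<close> into \<open>half V x y\<close> and \<open>half V y x\<close>.\<close>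

definition half :: "nat set \<Rightarrow> nat \<Rightarrow> nat \<Rightarrow> nat set" where
  "half V x y = {v \<in> V. v = x \<or> v = y \<or> cyclic x v y}"

lemma half_subset: "half V x y \<subseteq> V"
  by (auto simp: half_def)

lemma next_vertex_subset:
  "next_vertex V x y \<Longrightarrow> S \<subseteq> V \<Longrightarrow> x \<in> S \<Longrightarrow> y \<in> S \<Longrightarrow> next_vertex S x y"
  by (auto simp: next_vertex_def)

lemma next_vertex_half:
  assumes "x \<in> V" "y \<in> V" "next_vertex (half V x y) i j"
  shows "next_vertex V i j \<or> (i = y \<and> j = x)"
proof (rule ccontr)
  assume neg: "\<not> ?thesis"
  have ij: "i \<in> half V x y" "j \<in> half V x y" "i \<noteq> j"
    and no: "\<And>k. k \<in> half V x y \<Longrightarrow> \<not> cyclic i k j"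
    using assms(3) by (auto simp: next_vertex_def)
  then obtain k where k: "k \<in> V" "cyclic i k j"
    using neg half_subset[of V x y] unfolding next_vertex_def by blast
  have xy: "x \<in> half V x y" "y \<in> half V x y"
    using assms by (auto simp: half_def)
  have a: "i = x \<or> i = y \<or> cyclic x i y" "j = x \<or> j = y \<or> cyclic x j y"
    "\<not> (k = x \<or> k = y \<or> cyclic x k y)"
    using ij k no[of k] by (auto simp: half_def)
  \<comment> \<open>The gap from \<open>i\<close> to \<open>j\<close> contains \<open>k\<close>, which is outside the half, but neither \<open>x\<close> nor \<open>y\<close>.
    As \<open>i\<close> and \<open>j\<close> are in the half, it can only be the gap from \<open>y\<close> to \<open>x\<close>.\<close>
  show False
    using a no[OF xy(1)] no[OF xy(2)] k(2) ij(3) neg cyclic_rules by (smt (verit))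
qed

lemma boundary_arcs_half:
  assumes "x \<in> V" "y \<in> V"
  shows "boundary_arcs (half V x y) \<subseteq> insert {x, y} (boundary_arcs V)"
proof
  fix d assume "d \<in> boundary_arcs (half V x y)"
  then obtain i j where "d = {i, j}" "next_vertex (half V x y) i j"
    by (auto simp: boundary_arcs_def)
  then show "d \<in> insert {x, y} (boundary_arcs V)"
    using next_vertex_half[OF assms, of i j] by (auto simp: boundary_arc_iff)
qed

lemma next_vertex_half_cut:
  assumes "x \<in> V" "y \<in> V" "x \<noteq> y"
  shows "next_vertex (half V x y) y x"
  using assms unfolding next_vertex_def half_def by (auto simp: cyclic_def)

lemma card_half:
  assumes "finite V" "x \<in> V" "y \<in> V" "v \<in> V" "cyclic x v y"
  shows "card (half V x y) \<ge> 3"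
proof -
  have "{x, v, y} \<subseteq> half V x y" using assms by (auto simp: half_def)
  moreover have "card {x, v, y} = 3" using cyclic_distinct[OF assms(5)] by simp
  ultimately show ?thesis
    using assms(1) half_subset card_mono finite_subset by metis
qed

lemma half_psubset:
  assumes "v \<in> V" "cyclic y v x"
  shows "half V x y \<subset> V"
proof -
  have "v \<notin> half V x y" using assms(2) by (auto simp: half_def cyclic_def)
  then show ?thesis using assms(1) half_subset by blast
qed

lemma arc_within_half:
  assumes "{i, j} \<in> diagonals V" "x \<in> V" "y \<in> V" "x \<noteq> y" "\<not> crossing {x, y} {i, j}"
  shows "{i, j} \<subseteq> half V x y \<or> {i, j} \<subseteq> half V y x"
proof -
  have "i \<in> V" "j \<in> V" using assms(1) by (auto simp: diagonal_iff)
  moreover have "\<not> (cyclic x i y \<and> cyclic y j x)" "\<not> (cyclic x j y \<and> cyclic y i x)"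
    using assms(5) unfolding crossing_iff by blast+
  ultimately show ?thesis
    using assms(4) cyclic_total[of x i y] cyclic_total[of x j y] cyclic_rotate
    unfolding half_def by blast
qed

section \<open>Subpolygons at a given side\<close>

text \<open>As long as an arc of \<open>D\<close> divides \<open>W\<close>, one of its two halves still has the side from \<open>r\<close> to \<open>l\<close>,
  because no vertex lies between \<open>r\<close> and \<open>l\<close>. Passing to that half, one ends up with a polygon
  that no arc of \<open>D\<close> divides.\<close>

lemma subpolygon_at_side:
  assumes "finite W" "W \<subseteq> V" "card W \<ge> 3" "boundary_arcs W \<subseteq> boundary_arcs V \<union> D"
    and "next_vertex W r l"
  shows "\<exists>S \<subseteq> W. subpolygon V D S \<and> next_vertex S r l"
  using assms
proof (induction "card W" arbitrary: W rule: less_induct)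
  case less
  show ?case
  proof (cases "D \<inter> diagonals W = {}")
    case True
    then show ?thesis using less.prems unfolding subpolygon_def by blast
  next
    case False
    then obtain d where "d \<in> D" "d \<in> diagonals W" by blast
    moreover obtain p q where "d = {p, q}" using \<open>d \<in> diagonals W\<close> by (rule diagonal_cases)
    ultimately have d: "{p, q} \<in> D" "{p, q} \<in> diagonals W" by auto
    have step: ?thesis
      if "{x, y} = {p, q}" "r \<in> half W x y" "l \<in> half W x y" for x y
    proof -
      have xy: "{x, y} \<in> D" "{x, y} \<in> diagonals W" using d that(1) by auto
      then obtain v w where vw: "x \<in> W" "y \<in> W" "v \<in> W" "cyclic x v y" "w \<in> W" "cyclic y w x"
        unfolding diagonal_iff by blast
      have sub: "half W x y \<subset> W" using half_psubset vw by blast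
      have "\<exists>S\<subseteq>half W x y. subpolygon V D S \<and> next_vertex S r l"
      proof (rule less.hyps)
        show "card (half W x y) < card W" using sub less.prems(1) psubset_card_mono by blast
        show "finite (half W x y)" "half W x y \<subseteq> V"
          using sub less.prems(1,2) finite_subset by auto
        show "card (half W x y) \<ge> 3" using card_half less.prems(1) vw by blast
        show "boundary_arcs (half W x y) \<subseteq> boundary_arcs V \<union> D"
          using boundary_arcs_half[OF vw(1,2)] xy(1) less.prems(4) by blast
        show "next_vertex (half W x y) r l"
          using next_vertex_subset[OF less.prems(5) half_subset] that by blast
      qed
      then show ?thesis using sub by blast
    qed
    have pq: "p \<in> W" "q \<in> W" "p \<noteq> q"
      using d(2) unfolding diagonal_iff by (auto dest: cyclic_distinct)
    have "r \<in> W" "l \<in> W" "r \<noteq> l" "\<not> cyclic r p l" "\<not> cyclic r q l"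
      using less.prems(5) pq unfolding next_vertex_def by auto
    then have "(r \<in> half W p q \<and> l \<in> half W p q) \<or> (r \<in> half W q p \<and> l \<in> half W q p)"
      using pq cyclic_rules unfolding half_def mem_Collect_eq by (smt (verit))
    then show ?thesis using step[of p q] step[of q p] by (auto simp: insert_commute)
  qed
qed

lemma subpolygon_third_vertex:
  assumes "subpolygon V D S" "next_vertex S x y"
  obtains w where "w \<in> S" "cyclic y w x"
proof -
  have "card S \<ge> 3" using assms(1) by (simp add: subpolygon_def)
  then have "\<not> S \<subseteq> {x, y}"
    using card_mono[of "{x, y}" S] card_insert_le_m1[of 2 "{y}" x] by fastforce
  then obtain w where "w \<in> S" "w \<noteq> x" "w \<noteq> y" by blast
  then show thesis
    using that assms(2) cyclic_total[of x w y] cyclic_rotate unfolding next_vertex_def by metis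
qed

text \<open>This moves from a subpolygon to its neighbour: if some vertex of \<open>V\<close> lies beyond the side from \<open>x\<close>
  to \<open>y\<close>, then this side is not on the boundary of \<open>V\<close>. So it belongs to \<open>D\<close>, and another subpolygon
  adjoins it on the far side, where it is traversed from \<open>y\<close> to \<open>x\<close>.\<close>

lemma subpolygon_beyond_side:
  assumes "finite V" "subpolygon V D P" "next_vertex P x y" "v \<in> V" "cyclic x v y"
  shows "\<exists>S \<subseteq> half V x y. subpolygon V D S \<and> next_vertex S y x"
proof -
  obtain w where w: "w \<in> P" "cyclic y w x"
    using subpolygon_third_vertex[OF assms(2,3)] .
  have sub: "P \<subseteq> V" and bd: "boundary_arcs P \<subseteq> boundary_arcs V \<union> D"
    using assms(2) by (auto simp: subpolygon_def)
  have xy: "x \<in> V" "y \<in> V" "x \<noteq> y" using assms(3) sub by (auto simp: next_vertex_def)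
  have "{x, y} \<in> diagonals V" using xy w sub assms(4,5) unfolding diagonal_iff by blast
  then have "{x, y} \<in> D"
    using bd assms(3) boundary_arc_iff[of x y P] unfolding diagonals_def by blast
  then have bd': "boundary_arcs (half V x y) \<subseteq> boundary_arcs V \<union> D"
    using boundary_arcs_half[OF xy(1,2)] by blast
  show ?thesis
    using subpolygon_at_side[OF _ half_subset card_half[OF assms(1) xy(1,2) assms(4,5)] bd'
        next_vertex_half_cut[OF xy]] assms(1) half_subset finite_subset by metis
qed

lemma subpolygon_at_arc:
  assumes "finite V" "{x, y} \<in> D" "{x, y} \<in> diagonals V"
  shows "\<exists>S. subpolygon V D S \<and> {x, y} \<in> boundary_arcs S"
proof -
  obtain v where xy: "x \<in> V" "y \<in> V" "v \<in> V" "cyclic x v y"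
    using assms(3) unfolding diagonal_iff by blast
  have bd: "boundary_arcs (half V x y) \<subseteq> boundary_arcs V \<union> D"
    using boundary_arcs_half[OF xy(1,2)] assms(2) by blast
  have "x \<noteq> y" using cyclic_distinct[OF xy(4)] by simp
  then have "\<exists>S \<subseteq> half V x y. subpolygon V D S \<and> next_vertex S y x"
    using subpolygon_at_side[OF _ half_subset card_half[OF assms(1) xy] bd
        next_vertex_half_cut[OF xy(1,2)]] assms(1) half_subset finite_subset by metis
  then show ?thesis by (auto simp: boundary_arc_iff)
qed

section \<open>Restriction of a frieze to a polygon cut out of a dissection\<close>

text \<open>The Ptolemy relation in terms of the cyclic order: arcs with separated ends are automatically
  diagonals.\<close>

lemma ptolemy:
  assumes "frieze V f" "i \<in> V" "j \<in> V" "k \<in> V" "l \<in> V" "cyclic i k j" "cyclic j l i"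
  shows "f i j * f k l = f i l * f j k + f i k * f j l"
proof -
  have "{i, j} \<in> diagonals V" using assms unfolding diagonal_iff by blast
  moreover have "cyclic k j l" "cyclic l i k" using assms(6,7) by (auto simp: cyclic_def)
  then have "{k, l} \<in> diagonals V" using assms unfolding diagonal_iff by blast
  moreover have "crossing {i, j} {k, l}" using assms(6,7) unfolding crossing_iff by blast
  ultimately show ?thesis using assms(1) unfolding frieze_def by blast
qed

lemma frieze_symmetric:
  "frieze V f \<Longrightarrow> i \<in> V \<Longrightarrow> j \<in> V \<Longrightarrow> f i j = f j i"
  by (auto simp: frieze_def)

lemma frieze_from_dissection_arc:
  assumes "finite V" "noncrossing_diagonals V D" "frieze_from_dissection V D f" "{x, y} \<in> D"
  shows "f x y = 1"
proof -
  have "{x, y} \<in> diagonals V" using assms(2,4) by (auto simp: noncrossing_diagonals_def)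
  then obtain S where "subpolygon V D S" "{x, y} \<in> boundary_arcs S"
    using subpolygon_at_arc[OF assms(1,4)] by blast
  then show ?thesis using assms(3) unfolding frieze_from_dissection_def by blast
qed

lemma subpolygon_restrict:
  assumes "subpolygon Q (D \<inter> diagonals Q) S" "Q \<subseteq> V" "boundary_arcs Q \<subseteq> boundary_arcs V \<union> D"
  shows "subpolygon V D S"
  using assms diagonals_mono[of S Q] unfolding subpolygon_def by blast

text \<open>The sides of \<open>Q\<close> that are not sides of \<open>V\<close> are arcs of \<open>D\<close>, where \<open>f\<close> is \<open>1\<close>. This is the
  boundary condition of a frieze on \<open>Q\<close>; the other conditions are inherited.\<close>

lemma frieze_from_dissection_restrict:
  assumes "finite V" "noncrossing_diagonals V D" "frieze_from_dissection V D f"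
    and "Q \<subseteq> V" "boundary_arcs Q \<subseteq> boundary_arcs V \<union> D"
  shows "frieze_from_dissection Q (D \<inter> diagonals Q) f"
proof -
  have fr: "frieze V f" using assms(3) by (simp add: frieze_from_dissection_def)
  have sides: "f i j = 1 \<and> f j i = 1" if "next_vertex Q i j" for i j
  proof -
    have "{i, j} \<in> boundary_arcs V \<or> {i, j} \<in> D"
      using that assms(5) boundary_arc_iff[of i j Q] by blast
    then show ?thesis
    proof
      assume "{i, j} \<in> boundary_arcs V"
      then show ?thesis using fr unfolding boundary_arc_iff frieze_def by blast
    next
      assume "{i, j} \<in> D"
      then show ?thesis
        using frieze_from_dissection_arc[OF assms(1-3), of i j]
          frieze_from_dissection_arc[OF assms(1-3), of j i] by (simp add: insert_commute)
    qed
  qed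
  have "frieze Q f"
    unfolding frieze_def
  proof (intro conjI)
    show "\<forall>i\<in>Q. \<forall>j\<in>Q. (f i j = 0) = (i = j)" "\<forall>i\<in>Q. \<forall>j\<in>Q. f i j = f j i"
      using fr assms(4) unfolding frieze_def by blast+
    show "\<forall>i j. next_vertex Q i j \<longrightarrow> f i j = 1 \<and> f j i = 1"
      using sides by blast
    show "\<forall>i j k l. {i, j} \<in> diagonals Q \<and> {k, l} \<in> diagonals Q \<and> crossing {i, j} {k, l} \<longrightarrow>
        f i j * f k l = f i l * f j k + f i k * f j l"
      using fr diagonals_mono[OF assms(4)] unfolding frieze_def by blast
  qed
  then show ?thesis
    using subpolygon_restrict[OF _ assms(4,5)] assms(3) unfolding frieze_from_dissection_def by blast
qed

section \<open>Towers\<close>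

lemma one_plus_sqrt2_unit: "1 + sqrt2 dvd (1 :: zsqrt2)"
proof
  show "1 = (1 + sqrt2) * (sqrt2 - 1)" by transfer (simp add: algebra_simps)
qed

lemma quadrilateral_vertices:
  assumes "card S = 4" "next_vertex S r l"
  obtains x y where "S = {l, x, y, r}" "cyclic l x y" "cyclic l y r" "cyclic x y r" "cyclic l x r"
proof -
  have fin: "finite S" using assms(1) card.infinite by fastforce
  have lr: "l \<in> S" "r \<in> S" "l \<noteq> r" using assms(2) by (auto simp: next_vertex_def)
  have "card (S - {l, r}) = 2" using assms(1) fin lr by (simp add: card_Diff_subset)
  then obtain p q where pq: "S - {l, r} = {p, q}" "p \<noteq> q" by (auto simp: card_2_iff)
  have S: "S = {l, p, q, r}" "p \<noteq> l" "p \<noteq> r" "q \<noteq> l" "q \<noteq> r" using pq lr by auto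
  have "\<not> cyclic r p l" "\<not> cyclic r q l"
    using assms(2) S(1) unfolding next_vertex_def by auto
  then have *: "cyclic l p r" "cyclic l q r"
    using cyclic_total[of r p l] cyclic_total[of r q l] S lr cyclic_rotate by metis+
  show thesis
  proof (cases "cyclic l p q")
    case True
    then show thesis using that[of p q] * cyclic_trans[OF True *(2)] S(1) by blast
  next
    case False
    then have qp: "cyclic l q p" using cyclic_total[of l p q] S pq(2) by metis
    then show thesis using that[of q p] * cyclic_trans[OF qp *(1)] S(1) by blast
  qed
qed

lemma three_subpolygons_at_vertex:
  assumes "finite V" "card {S. subpolygon V D S \<and> v \<in> S} \<le> 2"
    and "subpolygon V D A" "subpolygon V D B" "subpolygon V D C"
    and "v \<in> A" "v \<in> B" "v \<in> C"
    and "A \<noteq> B" "B \<noteq> C" "A \<noteq> C"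
  shows False
proof -
  have "finite {S. subpolygon V D S \<and> v \<in> S}"
    using assms(1) finite_subset[of _ "Pow V"] by (auto simp: subpolygon_def)
  moreover have "{A, B, C} \<subseteq> {S. subpolygon V D S \<and> v \<in> S}" using assms by blast
  ultimately have "card {A, B, C} \<le> 2" using assms(2) by (meson card_mono le_trans)
  then show False using assms(9-11) by simp
qed

text \<open>Here \<open>{l, r}\<close> is a side of \<open>P\<close> that separates \<open>a\<close> from a row of quadrilaterals. In the row, the
  first quadrilateral \<open>l, x, y, r\<close> can only be continued across \<open>{x, y}\<close>, so the induction
  replaces \<open>P\<close> by this quadrilateral, \<open>l\<close> and \<open>r\<close> by \<open>x\<close> and \<open>y\<close>, and the common value \<open>u\<close> by
  \<open>u * (1 + sqrt2)\<close>.\<close>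

lemma strip_units:
  assumes "finite V" "frieze_from_dissection V D f"
    and two: "\<And>v. v \<in> V \<Longrightarrow> card {S. subpolygon V D S \<and> v \<in> S} \<le> 2"
    and quad: "\<And>S. subpolygon V D S \<Longrightarrow> a \<notin> S \<Longrightarrow> card S = 4"
    and "a \<in> V"
    and "subpolygon V D P" "next_vertex P l r" "cyclic r a l"
    and "f a l = u" "f a r = u" "u dvd 1"
    and "v \<in> V" "cyclic l v r"
  shows "f a v dvd 1"
  using assms(6-)
proof (induction "card (half V l r)" arbitrary: l r P u v rule: less_induct)
  case less
  have fr: "frieze V f" using assms(2) by (simp add: frieze_from_dissection_def)
  obtain S where S: "S \<subseteq> half V l r" "subpolygon V D S" "next_vertex S r l"
    using subpolygon_beyond_side[OF assms(1) less.prems(1,2,7,8)] by blast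
  have "a \<notin> half V l r" using less.prems(3) by (auto simp: half_def cyclic_def)
  then have card4: "card S = 4" using S quad by blast
  then obtain x y where xy: "S = {l, x, y, r}"
    and cyc: "cyclic l x y" "cyclic l y r" "cyclic x y r" "cyclic l x r"
    using quadrilateral_vertices[OF _ S(3)] by blast
  have inV: "l \<in> V" "r \<in> V" "x \<in> V" "y \<in> V" using S(2) xy by (auto simp: subpolygon_def)
  have P: "l \<in> P" "r \<in> P" "x \<notin> P"
    using less.prems(2) cyc unfolding next_vertex_def by auto
  have nexts: "next_vertex S l x" "next_vertex S x y" "next_vertex S y r"
  proof -
    have "\<not> cyclic l y x" "\<not> cyclic l r x" "\<not> cyclic x l y" "\<not> cyclic x r y"
      "\<not> cyclic y l r" "\<not> cyclic y x r"
      using cyc by (metis cyclic_rules)+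
    then show "next_vertex S l x" "next_vertex S x y" "next_vertex S y r"
      using cyc unfolding next_vertex_def xy by (auto dest: cyclic_distinct)
  qed
  have rotated: "cyclic y r l" "cyclic r l x" "cyclic x r l" "cyclic r l y"
    using cyc cyclic_rotate by blast+
  have "{l, y} \<in> diagonals S" "{x, r} \<in> diagonals S"
    unfolding diagonal_iff using xy cyc rotated by auto
  moreover have "{r, l} \<in> boundary_arcs S" "{l, x} \<in> boundary_arcs S" "{y, r} \<in> boundary_arcs S"
    using S(3) nexts unfolding boundary_arc_iff by blast+
  ultimately have vals: "f y l = sqrt2" "f x r = sqrt2" "f l r = 1" "f x l = 1" "f y r = 1"
    using S(2) card4 assms(2) unfolding frieze_from_dissection_def
    by (metis insert_commute)+
  have out: "cyclic a l x" "cyclic x r a" "cyclic a l y" "cyclic y r a" "cyclic y a x"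
    using cyc less.prems(3) by (metis cyclic_rules)+
  have fx: "f a x = u * (1 + sqrt2)"
    using ptolemy[OF fr assms(5) inV(3,1,2) out(1,2)] vals less.prems(4,5)
    by (simp add: algebra_simps)
  have fy: "f a y = u * (1 + sqrt2)"
    using ptolemy[OF fr assms(5) inV(4,1,2) out(3,4)] vals less.prems(4,5)
    by (simp add: algebra_simps)
  have unit: "u * (1 + sqrt2) dvd 1"
    using mult_dvd_mono[OF less.prems(6) one_plus_sqrt2_unit] by simp
  \<comment> \<open>A vertex beyond \<open>{l, x}\<close> would bring a third subpolygon to \<open>l\<close>, next to \<open>P\<close> and \<open>S\<close>.\<close>
  have "\<not> cyclic l v x"
  proof
    assume "cyclic l v x"
    then obtain A where A: "A \<subseteq> half V l x" "subpolygon V D A" "next_vertex A x l"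
      using subpolygon_beyond_side[OF assms(1) S(2) nexts(1) less.prems(7)] by blast
    have "r \<notin> half V l x"
      using cyc(4) by (auto simp: half_def dest: cyclic_distinct cyclic_asym)
    then have "r \<notin> A" using A(1) by blast
    moreover have "l \<in> A" using A(3) by (simp add: next_vertex_def)
    ultimately show False
      using three_subpolygons_at_vertex[OF assms(1) two[OF inV(1)] less.prems(1) S(2) A(2)] P xy
      by auto
  qed
  moreover have "\<not> cyclic y v r"
  proof
    assume "cyclic y v r"
    then obtain A where A: "A \<subseteq> half V y r" "subpolygon V D A" "next_vertex A r y"
      using subpolygon_beyond_side[OF assms(1) S(2) nexts(3) less.prems(7)] by blast
    have "l \<notin> half V y r"
      using rotated(1) by (auto simp: half_def dest: cyclic_distinct cyclic_asym)
    then have "l \<notin> A" using A(1) by blast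
    moreover have "r \<in> A" using A(3) by (simp add: next_vertex_def)
    ultimately show False
      using three_subpolygons_at_vertex[OF assms(1) two[OF inV(2)] less.prems(1) S(2) A(2)] P xy
      by auto
  qed
  ultimately consider "v = x" | "v = y" | "cyclic x v y"
    using cyc less.prems(8) cyclic_rules by (smt (verit))
  then show ?case
  proof cases
    case 3
    show ?thesis
    proof (rule less.hyps)
      have "\<not> cyclic x l y" "\<And>z. cyclic x z y \<Longrightarrow> cyclic l z r"
        using cyc by (metis cyclic_rules)+
      then have "l \<notin> half V x y" "l \<in> half V l r" "half V x y \<subseteq> half V l r"
        using cyc inV by (auto simp: half_def dest: cyclic_distinct)
      then have "half V x y \<subset> half V l r" by blast
      then show "card (half V x y) < card (half V l r)"
        using assms(1) half_subset finite_subset psubset_card_mono by metis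
      show "cyclic y a x" by (fact out(5))
    qed (use S nexts fx fy unit less.prems 3 in auto)
  qed (use fx fy unit in auto)
qed

text \<open>A vertex \<open>w\<close> beyond \<open>{b, c}\<close> means that a subpolygon adjoins the triangle there. As \<open>b\<close> and
  \<open>c\<close> then already lie in two subpolygons, nothing adjoins the other two sides, and the strip
  beyond \<open>{b, c}\<close> contains all vertices except \<open>a\<close>.\<close>

lemma triangle_apex_units:
  assumes "finite V" "frieze_from_dissection V D f"
    and two: "\<And>v. v \<in> V \<Longrightarrow> card {S. subpolygon V D S \<and> v \<in> S} \<le> 2"
    and quad: "\<And>S. subpolygon V D S \<Longrightarrow> S \<noteq> {a, b, c} \<Longrightarrow> card S = 4"
    and tri: "subpolygon V D {a, b, c}" and cyc: "cyclic a b c"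
    and w: "w \<in> V" "cyclic b w c"
    and v: "v \<in> V" "v \<noteq> a"
  shows "f a v dvd 1"
proof -
  let ?S = "{a, b, c}"
  have inV: "a \<in> V" "b \<in> V" "c \<in> V" using tri by (auto simp: subpolygon_def)
  have nexts: "next_vertex ?S a b" "next_vertex ?S b c" "next_vertex ?S c a"
    using cyc unfolding next_vertex_def by (auto simp: cyclic_def)
  have "{a, b} \<in> boundary_arcs ?S" "{a, c} \<in> boundary_arcs ?S"
    using nexts unfolding boundary_arc_iff by blast+
  then have f1: "f a b = 1" "f a c = 1"
    using assms(2) tri unfolding frieze_from_dissection_def by blast+
  obtain A where A: "A \<subseteq> half V b c" "subpolygon V D A" "next_vertex A c b"
    using subpolygon_beyond_side[OF assms(1) tri nexts(2) w] by blast
  have "a \<notin> half V b c" using cyc by (auto simp: half_def cyclic_def)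
  then have "A \<noteq> ?S" using A(1) by blast
  have bcA: "b \<in> A" "c \<in> A" using A(3) by (auto simp: next_vertex_def)
  have "\<not> cyclic a v b"
  proof
    assume "cyclic a v b"
    then obtain B where B: "B \<subseteq> half V a b" "subpolygon V D B" "next_vertex B b a"
      using subpolygon_beyond_side[OF assms(1) tri nexts(1) v(1)] by blast
    have "c \<notin> half V a b" using cyc by (auto simp: half_def cyclic_def)
    then have "c \<notin> B" using B(1) by blast
    moreover have "b \<in> B" using B(3) by (simp add: next_vertex_def)
    ultimately show False
      using three_subpolygons_at_vertex[OF assms(1) two[OF inV(2)] tri A(2) B(2)] bcA \<open>A \<noteq> ?S\<close>
      by auto
  qed
  moreover have "\<not> cyclic c v a"
  proof
    assume "cyclic c v a"
    then obtain B where B: "B \<subseteq> half V c a" "subpolygon V D B" "next_vertex B a c"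
      using subpolygon_beyond_side[OF assms(1) tri nexts(3) v(1)] by blast
    have "b \<notin> half V c a" using cyc by (auto simp: half_def cyclic_def)
    then have "b \<notin> B" using B(1) by blast
    moreover have "c \<in> B" using B(3) by (simp add: next_vertex_def)
    ultimately show False
      using three_subpolygons_at_vertex[OF assms(1) two[OF inV(3)] tri A(2) B(2)] bcA \<open>A \<noteq> ?S\<close>
      by auto
  qed
  ultimately consider "v = b" | "v = c" | "cyclic b v c"
    using cyc v(2) cyclic_rules by (smt (verit))
  then show ?thesis
  proof cases
    case 3
    show ?thesis
    proof (rule strip_units[OF assms(1,2) two _ inV(1) tri nexts(2) _ f1 _ v(1) 3])
      show "cyclic c a b" using cyc by (auto simp: cyclic_def)
      show "\<And>S. subpolygon V D S \<Longrightarrow> a \<notin> S \<Longrightarrow> card S = 4" using quad by blast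
    qed simp_all
  qed (use f1 in auto)
qed

text \<open>If the tower is more than its triangle \<open>T\<close>, any further vertex lies beyond some side of \<open>T\<close>,
  and the vertex of \<open>T\<close> opposite to that side serves as \<open>a\<close>.\<close>

lemma tower_apex_units:
  assumes "tower m V D" "frieze_from_dissection V D f"
  shows "\<exists>a\<in>V. \<forall>v\<in>V. v \<noteq> a \<longrightarrow> f a v dvd 1"
proof -
  have fin: "finite V" using assms(1) card.infinite by (fastforce simp: tower_def)
  have two: "\<And>v. v \<in> V \<Longrightarrow> card {S. subpolygon V D S \<and> v \<in> S} \<le> 2"
    and dis: "\<And>S. subpolygon V D S \<Longrightarrow> card S = 3 \<or> card S = 4"
    and one: "card {S. subpolygon V D S \<and> card S = 3} = 1"
    using assms(1) by (auto simp: tower_def dissection_def)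
  obtain T where T: "{S. subpolygon V D S \<and> card S = 3} = {T}"
    using one by (auto simp: card_1_singleton_iff)
  then have tri: "subpolygon V D T" "card T = 3" by auto
  have quad: "card S = 4" if "subpolygon V D S" "S \<noteq> T" for S
    using dis[OF that(1)] that T by blast
  obtain p q r where "T = {p, q, r}" "p \<noteq> q" "q \<noteq> r" "p \<noteq> r"
    using tri(2) by (auto simp: card_3_iff)
  then obtain a b c where abc: "T = {a, b, c}" "cyclic a b c"
    using cyclic_total[of p q r] by (metis insert_commute)
  have rot: "{a, b, c} = {b, c, a}" "{a, b, c} = {c, a, b}" by auto
  have sub: "T \<subseteq> V" using tri by (auto simp: subpolygon_def)
  show ?thesis
  proof (cases "V \<subseteq> T")
    case True
    have "next_vertex T a b" "next_vertex T c a"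
      using abc unfolding next_vertex_def by (auto simp: cyclic_def)
    then have "f a b = 1" "f a c = 1"
      using assms(2) tri(1) unfolding frieze_from_dissection_def boundary_arc_iff by blast+
    then have "\<forall>v\<in>V. v \<noteq> a \<longrightarrow> f a v dvd 1" using True abc(1) by auto
    then show ?thesis using sub abc(1) by blast
  next
    case False
    then obtain w where w: "w \<in> V" "w \<notin> T" by blast
    then consider "cyclic b w c" | "cyclic c w a" | "cyclic a w b"
      using abc cyclic_rules by (smt (verit) insert_iff)
    then show ?thesis
    proof cases
      case 1
      have "f a v dvd 1" if "v \<in> V" "v \<noteq> a" for v
        using triangle_apex_units[OF fin assms(2) two, of a b c w v] quad tri(1) abc w(1) 1 that
        by auto
      then show ?thesis using sub abc(1) by blast
    next
      case 2
      have "cyclic b c a" using abc(2) cyclic_rotate by blast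
      then have "f b v dvd 1" if "v \<in> V" "v \<noteq> b" for v
        using triangle_apex_units[OF fin assms(2) two, of b c a w v] quad tri(1) abc(1) w(1) 2 that
          rot by auto
      then show ?thesis using sub abc(1) by blast
    next
      case 3
      have "cyclic c a b" using abc(2) cyclic_rotate by blast
      then have "f c v dvd 1" if "v \<in> V" "v \<noteq> c" for v
        using triangle_apex_units[OF fin assms(2) two, of c a b w v] quad tri(1) abc(1) w(1) 3 that
          rot by auto
      then show ?thesis using sub abc(1) by blast
    qed
  qed
qed

section \<open>Triangulations\<close>

text \<open>Maximality: an arc that avoids \<open>a\<close> and has a vertex \<open>v\<close> beyond it, as seen from \<open>a\<close>, crosses the
  diagonal \<open>{a, v}\<close>.\<close>

lemma fan_triangulation:
  assumes "a \<in> V"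
  shows "triangulation V {d \<in> diagonals V. a \<in> d}"
  unfolding triangulation_def
proof (intro conjI allI impI)
  show "noncrossing_diagonals V {d \<in> diagonals V. a \<in> d}"
    unfolding noncrossing_diagonals_def
  proof (intro conjI ballI)
    fix d e assume "d \<in> {d \<in> diagonals V. a \<in> d}" "e \<in> {d \<in> diagonals V. a \<in> d}"
    then obtain i j k l where "d = {i, j}" "e = {k, l}" "a \<in> {i, j}" "a \<in> {k, l}"
      by (metis (mono_tags) diagonal_cases mem_Collect_eq)
    then show "\<not> crossing d e" by (auto simp: crossing_iff dest: cyclic_distinct)
  qed blast
next
  fix T' assume T': "noncrossing_diagonals V T' \<and> {d \<in> diagonals V. a \<in> d} \<subseteq> T'"
  have "a \<in> d" if "d \<in> T'" for d
  proof (rule ccontr)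
    assume na: "a \<notin> d"
    have dd: "d \<in> diagonals V" using that T' by (auto simp: noncrossing_diagonals_def)
    have key: False if d: "d = {i, j}" and a: "cyclic j a i" for i j
    proof -
      obtain v where v: "v \<in> V" "cyclic i v j" "i \<in> V" "j \<in> V"
        using dd unfolding d diagonal_iff by blast
      have "cyclic a i v" "cyclic v j a" using v(2) a by (metis cyclic_rules)+
      then have "{a, v} \<in> diagonals V"
        unfolding diagonal_iff using assms v by blast
      then have "{a, v} \<in> T'" using T' by blast
      moreover have "crossing d {a, v}" using d a v(2) by (simp add: crossing_iff)
      ultimately show False using T' \<open>d \<in> T'\<close> unfolding noncrossing_diagonals_def by blast
    qed
    obtain i j where ij: "d = {i, j}" using dd by (rule diagonal_cases)
    then have "i \<noteq> j" using dd by (auto simp: diagonal_iff dest: cyclic_distinct)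
    then show False
      using key[of i j] key[of j i] ij na cyclic_total[of i a j] cyclic_rotate
      by (auto simp: insert_commute)
  qed
  then show "T' = {d \<in> diagonals V. a \<in> d}"
    using T' by (auto simp: noncrossing_diagonals_def)
qed

lemma unitary_if_apex_units:
  assumes "frieze V f" "a \<in> V" "\<forall>v\<in>V. v \<noteq> a \<longrightarrow> f a v dvd 1"
  shows "unitary V f"
  unfolding unitary_def
proof (intro exI conjI allI impI)
  fix i j assume "{i, j} \<in> {d \<in> diagonals V. a \<in> d}"
  then have "i \<in> V" "j \<in> V" "i \<noteq> j" "a = i \<or> a = j"
    by (auto simp: diagonal_iff dest: cyclic_distinct)
  then show "f i j dvd 1"
    using assms(3) frieze_symmetric[OF assms(1), of i j] by auto
qed (rule fan_triangulation[OF assms(2)])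

lemma noncrossing_halves:
  assumes "{i, j} \<subseteq> half V x y" "{k, l} \<subseteq> half V y x"
  shows "\<not> crossing {i, j} {k, l}"
proof -
  have "i = x \<or> i = y \<or> cyclic x i y" "j = x \<or> j = y \<or> cyclic x j y"
    "k = y \<or> k = x \<or> cyclic y k x" "l = y \<or> l = x \<or> cyclic y l x"
    using assms by (auto simp: half_def)
  then show ?thesis unfolding crossing_iff using cyclic_rules by (smt (verit))
qed

text \<open>An arc that does not cross the cut \<open>{x, y}\<close> has both ends in one half. If it differs from the cut,
  it is a diagonal of that half, where the given triangulation is maximal.\<close>

lemma glue_triangulations:
  assumes xy: "{x, y} \<in> diagonals V"
    and T1: "triangulation (half V x y) T1" and T2: "triangulation (half V y x) T2"
  shows "triangulation V (insert {x, y} (T1 \<union> T2))"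
proof -
  have inV: "x \<in> V" "y \<in> V" "x \<noteq> y" using xy by (auto simp: diagonal_iff dest: cyclic_distinct)
  have d1: "T1 \<subseteq> diagonals (half V x y)" and d2: "T2 \<subseteq> diagonals (half V y x)"
    and nc1: "\<And>d e. d \<in> T1 \<Longrightarrow> e \<in> T1 \<Longrightarrow> \<not> crossing d e"
    and nc2: "\<And>d e. d \<in> T2 \<Longrightarrow> e \<in> T2 \<Longrightarrow> \<not> crossing d e"
    using T1 T2 by (auto simp: triangulation_def noncrossing_diagonals_def)
  have ends: "\<exists>i j. d = {i, j} \<and> {i, j} \<subseteq> H"
    if "d \<in> insert {x, y} T" "T \<subseteq> diagonals H" "x \<in> H" "y \<in> H" for d T H
  proof -
    have dH: "d \<in> diagonals H \<or> d = {x, y}" using that by blast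
    then obtain i j where "d = {i, j}" by (metis diagonal_cases)
    moreover from this have "{i, j} \<subseteq> H"
      using dH that(3,4) by (auto simp: diagonal_iff doubleton_eq_iff)
    ultimately show ?thesis by blast
  qed
  have xyh: "x \<in> half V x y" "y \<in> half V x y" "x \<in> half V y x" "y \<in> half V y x"
    using inV by (auto simp: half_def)
  have across: "\<not> crossing d e \<and> \<not> crossing e d"
    if d: "d \<in> insert {x, y} T1" and e: "e \<in> insert {x, y} T2" for d e
  proof -
    obtain i j where ij: "d = {i, j}" "{i, j} \<subseteq> half V x y"
      using ends[OF d d1 xyh(1,2)] by blast
    obtain k l where kl: "e = {k, l}" "{k, l} \<subseteq> half V y x"
      using ends[OF e d2 xyh(3,4)] by blast
    show ?thesis
      unfolding ij(1) kl(1)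
      using noncrossing_halves[OF ij(2) kl(2)] crossing_commute[of k l i j] by blast
  qed
  have nc: "noncrossing_diagonals V (insert {x, y} (T1 \<union> T2))"
    unfolding noncrossing_diagonals_def
  proof (intro conjI ballI)
    show "insert {x, y} (T1 \<union> T2) \<subseteq> diagonals V"
      using d1 d2 xy diagonals_mono[OF half_subset] by blast
  next
    fix d e
    assume de: "d \<in> insert {x, y} (T1 \<union> T2)" "e \<in> insert {x, y} (T1 \<union> T2)"
    consider "d \<in> T1" "e \<in> T1" | "d \<in> T2" "e \<in> T2"
      | "d \<in> insert {x, y} T1" "e \<in> insert {x, y} T2"
      | "e \<in> insert {x, y} T1" "d \<in> insert {x, y} T2"
      using de by (elim insertE UnE) simp_all
    then show "\<not> crossing d e"
      by cases (simp_all only: nc1 nc2 across not_False_eq_True)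
  qed
  have "T' = insert {x, y} (T1 \<union> T2)"
    if T': "noncrossing_diagonals V T'" "insert {x, y} (T1 \<union> T2) \<subseteq> T'" for T'
  proof (intro equalityI subsetI)
    fix e assume e: "e \<in> T'"
    then have ediag: "e \<in> diagonals V" using T' by (auto simp: noncrossing_diagonals_def)
    then obtain i j where ij: "e = {i, j}" by (rule diagonal_cases)
    have "\<not> crossing {x, y} {i, j}" using T' e ij unfolding noncrossing_diagonals_def by blast
    then have side: "{i, j} \<subseteq> half V x y \<or> {i, j} \<subseteq> half V y x"
      using arc_within_half ediag ij inV by blast
    have in_half: "e \<in> T"
      if "{p, q} = {x, y}" "{i, j} \<subseteq> half V p q" "triangulation (half V p q) T" "T \<subseteq> T'"
        "e \<noteq> {x, y}" for p q T
    proof -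
      have "p \<in> V" "q \<in> V" using that(1) inV by auto
      then have "e \<notin> boundary_arcs (half V p q)"
        using boundary_arcs_half[of p V q] ediag that(1,5) unfolding diagonals_def by blast
      moreover have "i \<noteq> j" using ediag ij by (auto simp: diagonal_iff dest: cyclic_distinct)
      ultimately have "e \<in> diagonals (half V p q)"
        using that(2) ij unfolding diagonals_def arcs_def by blast
      then have "noncrossing_diagonals (half V p q) (insert e T)"
        using that(3,4) T'(1) e unfolding triangulation_def noncrossing_diagonals_def by blast
      then show "e \<in> T" using that(3) unfolding triangulation_def by blast
    qed
    show "e \<in> insert {x, y} (T1 \<union> T2)"
      using side in_half[OF refl _ T1] in_half[OF insert_commute _ T2] T'(2) by blast
  qed (use T' in blast)
  then show ?thesis using nc unfolding triangulation_def by blast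
qed

text \<open>The statement is about all polygons \<open>W\<close> cut out of \<open>V\<close> by arcs in \<open>C\<close>, so that both halves
  of \<open>W\<close> qualify and the subpolygons always refer to the fixed pair \<open>V\<close>, \<open>C\<close>. The case
  \<open>W = V\<close> is the one of interest.\<close>

lemma unitary_by_cutting:
  assumes "finite W" "W \<subseteq> V" "card W \<ge> 3" "boundary_arcs W \<subseteq> boundary_arcs V \<union> C"
    and pieces: "\<And>Q. subpolygon V C Q \<Longrightarrow> unitary Q f"
    and cuts: "\<And>x y. {x, y} \<in> C \<Longrightarrow> f x y dvd 1"
  shows "unitary W f"
  using assms(1-4)
proof (induction "card W" arbitrary: W rule: less_induct)
  case less
  show ?case
  proof (cases "C \<inter> diagonals W = {}")
    case True
    then show ?thesis using less.prems pieces unfolding subpolygon_def by blast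
  next
    case False
    then obtain d where d: "d \<in> C" "d \<in> diagonals W" by blast
    obtain x y where xy: "d = {x, y}" using d(2) by (rule diagonal_cases)
    have "unitary (half W p q) f" if "{p, q} = {x, y}" for p q
    proof (rule less.hyps)
      have pq: "{p, q} \<in> C" "{p, q} \<in> diagonals W" using d xy that by auto
      then obtain v w where vw: "p \<in> W" "q \<in> W" "v \<in> W" "cyclic p v q" "w \<in> W" "cyclic q w p"
        unfolding diagonal_iff by blast
      have sub: "half W p q \<subset> W" using half_psubset vw by blast
      show "card (half W p q) < card W" using sub less.prems(1) psubset_card_mono by blast
      show "finite (half W p q)" "half W p q \<subseteq> V"
        using sub less.prems(1,2) finite_subset by auto
      show "card (half W p q) \<ge> 3" using card_half less.prems(1) vw by blast
      show "boundary_arcs (half W p q) \<subseteq> boundary_arcs V \<union> C"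
        using boundary_arcs_half[OF vw(1,2)] pq(1) less.prems(4) by blast
    qed
    from this[of x y] this[of y x] obtain T1 T2
      where T: "triangulation (half W x y) T1" "triangulation (half W y x) T2"
        "\<forall>i j. {i, j} \<in> T1 \<longrightarrow> f i j dvd 1" "\<forall>i j. {i, j} \<in> T2 \<longrightarrow> f i j dvd 1"
      unfolding unitary_def by (auto simp: insert_commute)
    have "triangulation W (insert {x, y} (T1 \<union> T2))"
      using glue_triangulations T(1,2) d(2) xy by blast
    moreover have "\<forall>i j. {i, j} \<in> insert {x, y} (T1 \<union> T2) \<longrightarrow> f i j dvd 1"
      using T(3,4) cuts d(1) xy by (metis Un_iff insert_iff)
    ultimately show ?thesis unfolding unitary_def by blast
  qed
qed

theorem theorem1:
  fixes n :: nat and D :: "nat set set" and f :: "nat \<Rightarrow> nat \<Rightarrow> zsqrt2"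
  assumes "n \<ge> 3"
    and "dissection {0..<n} D"
    and "decomposable_into_towers {0..<n} D"
    and "frieze_from_dissection {0..<n} D f"
  shows "unitary {0..<n} f"
proof -
  let ?V = "{0..<n}"
  have nc: "noncrossing_diagonals ?V D" using assms(2) by (simp add: dissection_def)
  obtain C where C: "C \<subseteq> D"
    and tower: "\<And>Q. subpolygon ?V C Q \<Longrightarrow> \<exists>m. tower m Q (D \<inter> diagonals Q)"
    using assms(3) unfolding decomposable_into_towers_def by blast
  show ?thesis
  proof (rule unitary_by_cutting[where V = ?V and C = C])
    fix Q assume Q: "subpolygon ?V C Q"
    then have "Q \<subseteq> ?V" "boundary_arcs Q \<subseteq> boundary_arcs ?V \<union> D"
      using C by (auto simp: subpolygon_def)
    then have fQ: "frieze_from_dissection Q (D \<inter> diagonals Q) f"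
      using frieze_from_dissection_restrict nc assms(4) by blast
    obtain m where "tower m Q (D \<inter> diagonals Q)" using tower[OF Q] by blast
    then obtain a where "a \<in> Q" "\<forall>v\<in>Q. v \<noteq> a \<longrightarrow> f a v dvd 1"
      using tower_apex_units fQ by blast
    then show "unitary Q f"
      using unitary_if_apex_units fQ by (auto simp: frieze_from_dissection_def)
  next
    fix x y assume "{x, y} \<in> C"
    then have "f x y = 1" using frieze_from_dissection_arc[OF _ nc assms(4)] C by blast
    then show "f x y dvd 1" by simp
  qed (use assms(1) in auto)
qed

end
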